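(* Let $P$ be a definite clause program and $Q$ a query (a finite conjunction of atoms) over a first-order language with set of function symbols $\mathscr{F}$ (whose Herbrand universe is nonempty). Suppose that (a) $\mathscr{F}$ contains a non-constant function symbol (arity $>0$) not occurring in $P$, or (b) for each atom $A$ of $Q$ with exactly $k\geq 0$ distinct variables, $\mathscr{F}$ contains at least $k$ constants not occurring in $P$ or in $A$. Then $\mathcal{M}_P\models Q$ if and only if $P\models Q$.
   Context: $\mathcal{M}_P$ denotes the least Herbrand model of $P$ over the Herbrand universe built from all function symbols of the underlying language $\mathscr{F}$ (not only those occurring in $P$). A non-closed formula is true in an interpretation or entailed by a theory iff its universal closure is; thus $P\models Q$ means $P\models\forall Q$ and $\mathcal{M}_P\models Q$ means $\mathcal{M}_P\models\forall Q$. Constants are function symbols of arity $0$. *)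

theory Defs
  imports Main
begin

text \<open>A signature is a set of pairs of a name and an arity, so a symbol is a pair and \<open>(f, 0)\<close> is a
  constant. Terms and atoms are variadic; membership in a signature fixes the arities.\<close>

datatype ('f, vars_term: 'v) "term" =
  Var 'v
| Fun 'f "('f, 'v) term list"

datatype ('f, 'p, 'v) atom = Atom 'p "('f, 'v) term list"

datatype ('f, 'p, 'v) clause =
  Clause (head: "('f, 'p, 'v) atom") (body: "('f, 'p, 'v) atom list")

type_synonym ('f, 'p, 'v) program = "('f, 'p, 'v) clause set"
type_synonym ('f, 'p, 'v) query = "('f, 'p, 'v) atom list"

fun funas_term :: "('f, 'v) term \<Rightarrow> ('f \<times> nat) set" where
  "funas_term (Var x) = {}"
| "funas_term (Fun f ts) = {(f, length ts)} \<union> (\<Union>t \<in> set ts. funas_term t)"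

fun vars_atom :: "('f, 'p, 'v) atom \<Rightarrow> 'v set" where
  "vars_atom (Atom p ts) = (\<Union>t \<in> set ts. vars_term t)"

fun funas_atom :: "('f, 'p, 'v) atom \<Rightarrow> ('f \<times> nat) set" where
  "funas_atom (Atom p ts) = (\<Union>t \<in> set ts. funas_term t)"

fun predas_atom :: "('f, 'p, 'v) atom \<Rightarrow> 'p \<times> nat" where
  "predas_atom (Atom p ts) = (p, length ts)"

definition atoms_clause :: "('f, 'p, 'v) clause \<Rightarrow> ('f, 'p, 'v) atom set" where
  "atoms_clause C = insert (head C) (set (body C))"

definition funas_program :: "('f, 'p, 'v) program \<Rightarrow> ('f \<times> nat) set" where
  "funas_program P = (\<Union>C \<in> P. \<Union>A \<in> atoms_clause C. funas_atom A)"

definition wf_atom :: "('f \<times> nat) set \<Rightarrow> ('p \<times> nat) set \<Rightarrow> ('f, 'p, 'v) atom \<Rightarrow> bool" where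
  "wf_atom F R A \<longleftrightarrow> funas_atom A \<subseteq> F \<and> predas_atom A \<in> R"

definition wf_program :: "('f \<times> nat) set \<Rightarrow> ('p \<times> nat) set \<Rightarrow> ('f, 'p, 'v) program \<Rightarrow> bool" where
  "wf_program F R P \<longleftrightarrow> (\<forall>C \<in> P. \<forall>A \<in> atoms_clause C. wf_atom F R A)"

definition wf_query :: "('f \<times> nat) set \<Rightarrow> ('p \<times> nat) set \<Rightarrow> ('f, 'p, 'v) query \<Rightarrow> bool" where
  "wf_query F R Q \<longleftrightarrow> (\<forall>A \<in> set Q. wf_atom F R A)"


record ('f, 'p, 'd) interp =
  idom :: "'d set"
  ifun :: "'f \<Rightarrow> 'd list \<Rightarrow> 'd"
  ipred :: "'p \<Rightarrow> 'd list \<Rightarrow> bool"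

definition is_interp :: "('f \<times> nat) set \<Rightarrow> ('f, 'p, 'd) interp \<Rightarrow> bool" where
  "is_interp F I \<longleftrightarrow> idom I \<noteq> {} \<and>
    (\<forall>(f, n) \<in> F. \<forall>ds. length ds = n \<and> set ds \<subseteq> idom I \<longrightarrow> ifun I f ds \<in> idom I)"

fun eval :: "('f, 'p, 'd) interp \<Rightarrow> ('v \<Rightarrow> 'd) \<Rightarrow> ('f, 'v) term \<Rightarrow> 'd" where
  "eval I \<alpha> (Var x) = \<alpha> x"
| "eval I \<alpha> (Fun f ts) = ifun I f (map (eval I \<alpha>) ts)"

fun sat_atom :: "('f, 'p, 'd) interp \<Rightarrow> ('v \<Rightarrow> 'd) \<Rightarrow> ('f, 'p, 'v) atom \<Rightarrow> bool" where
  "sat_atom I \<alpha> (Atom p ts) \<longleftrightarrow> ipred I p (map (eval I \<alpha>) ts)"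

definition true_clause :: "('f, 'p, 'd) interp \<Rightarrow> ('f, 'p, 'v) clause \<Rightarrow> bool" where
  "true_clause I C \<longleftrightarrow>
    (\<forall>\<alpha>. range \<alpha> \<subseteq> idom I \<longrightarrow> (\<forall>B \<in> set (body C). sat_atom I \<alpha> B) \<longrightarrow> sat_atom I \<alpha> (head C))"

definition true_query :: "('f, 'p, 'd) interp \<Rightarrow> ('f, 'p, 'v) query \<Rightarrow> bool" where
  "true_query I Q \<longleftrightarrow> (\<forall>\<alpha>. range \<alpha> \<subseteq> idom I \<longrightarrow> (\<forall>A \<in> set Q. sat_atom I \<alpha> A))"

definition is_model :: "('f, 'p, 'd) interp \<Rightarrow> ('f, 'p, 'v) program \<Rightarrow> bool" where
  "is_model I P \<longleftrightarrow> (\<forall>C \<in> P. true_clause I C)"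

text \<open>Logical consequence over all interpretations whose domain is a nonempty subset of the type
  \<open>'u\<close>. HOL cannot quantify over types inside a formula, so the type is a parameter;
  \<open>entails_inj\<close> below shows that a larger type gives a stronger relation. With \<open>'u = 'd + ('f, 'v) term\<close> for an
  arbitrary type \<open>'d\<close>, all interpretations over \<open>'d\<close> and all Herbrand interpretations are covered.\<close>

definition entails ::
  "'u itself \<Rightarrow> ('f \<times> nat) set \<Rightarrow> ('f, 'p, 'v) program \<Rightarrow> ('f, 'p, 'v) query \<Rightarrow> bool" where
  "entails (U :: 'u itself) F P Q \<longleftrightarrow>
    (\<forall>I :: ('f, 'p, 'u) interp. is_interp F I \<longrightarrow> is_model I P \<longrightarrow> true_query I Q)"


definition herbrand_universe :: "('f \<times> nat) set \<Rightarrow> ('f, 'v) term set" where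
  "herbrand_universe F = {t. vars_term t = {} \<and> funas_term t \<subseteq> F}"

definition herbrand_base :: "('f \<times> nat) set \<Rightarrow> ('p \<times> nat) set \<Rightarrow> ('f, 'p, 'v) atom set" where
  "herbrand_base F R = {A. vars_atom A = {} \<and> wf_atom F R A}"

definition herbrand_interp ::
  "('f \<times> nat) set \<Rightarrow> ('f, 'p, 'v) atom set \<Rightarrow> ('f, 'p, ('f, 'v) term) interp" where
  "herbrand_interp F M =
    \<lparr>idom = herbrand_universe F, ifun = Fun, ipred = (\<lambda>p ts. Atom p ts \<in> M)\<rparr>"

definition herbrand_model ::
  "('f \<times> nat) set \<Rightarrow> ('p \<times> nat) set \<Rightarrow> ('f, 'p, 'v) program \<Rightarrow> ('f, 'p, 'v) atom set \<Rightarrow> bool" where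
  "herbrand_model F R P M \<longleftrightarrow> M \<subseteq> herbrand_base F R \<and> is_model (herbrand_interp F M) P"

definition least_herbrand_model ::
  "('f \<times> nat) set \<Rightarrow> ('p \<times> nat) set \<Rightarrow> ('f, 'p, 'v) program \<Rightarrow> ('f, 'p, 'v) atom set" where
  "least_herbrand_model F R P = (LEAST M. herbrand_model F R P M)"


lemma eval_herbrand_universe:
  assumes "range \<alpha> \<subseteq> herbrand_universe F" and "funas_term t \<subseteq> F"
  shows "eval (herbrand_interp F M) \<alpha> t \<in> herbrand_universe F"
  using assms(2)
proof (induction t)
  case (Var x)
  then show ?case using assms(1) by auto
next
  case (Fun f ts)
  have "\<forall>t \<in> set ts. eval (herbrand_interp F M) \<alpha> t \<in> herbrand_universe F"
    using Fun by (auto simp: UN_subset_iff)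
  then show ?case
    using Fun.prems by (auto simp: herbrand_interp_def herbrand_universe_def)
qed

lemma eval_herbrand_interp_cong:
  "eval (herbrand_interp F M) \<alpha> t = eval (herbrand_interp F N) \<alpha> t"
  by (induction t) (auto simp: herbrand_interp_def)

lemma herbrand_model_base:
  assumes "wf_program F R P"
  shows "herbrand_model F R P (herbrand_base F R)"
proof -
  let ?I = "herbrand_interp F (herbrand_base F R)"
  have "sat_atom ?I \<alpha> (head C)" if C: "C \<in> P" and \<alpha>: "range \<alpha> \<subseteq> idom ?I" for C \<alpha>
  proof -
    obtain p ts where A: "head C = Atom p ts" by (cases "head C")
    have wf: "wf_atom F R (Atom p ts)"
      using assms C A by (auto simp: wf_program_def atoms_clause_def)
    have "\<forall>t \<in> set ts. eval ?I \<alpha> t \<in> herbrand_universe F"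
      using wf \<alpha> by (intro ballI eval_herbrand_universe)
        (auto simp: wf_atom_def herbrand_interp_def)
    then have "Atom p (map (eval ?I \<alpha>) ts) \<in> herbrand_base F R"
      using wf by (auto simp: herbrand_base_def wf_atom_def herbrand_universe_def)
    then show ?thesis
      using A by (simp add: herbrand_interp_def)
  qed
  then show ?thesis
    by (auto simp: herbrand_model_def is_model_def true_clause_def)
qed

lemma herbrand_model_Inter:
  assumes ne: "\<M> \<noteq> {}" and mods: "\<forall>M \<in> \<M>. herbrand_model F R P M"
  shows "herbrand_model F R P (\<Inter>\<M>)"
proof -
  have sat: "sat_atom (herbrand_interp F (\<Inter>\<M>)) \<alpha> A \<longleftrightarrow>
      (\<forall>M \<in> \<M>. sat_atom (herbrand_interp F M) \<alpha> A)" for \<alpha> :: "'c \<Rightarrow> ('a, 'c) term" and A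
  proof (cases A)
    case (Atom p ts)
    define us where "us = map (eval (herbrand_interp F ({} :: ('a, 'b, 'c) atom set)) \<alpha>) ts"
    have ev: "map (eval (herbrand_interp F M) \<alpha>) ts = us" for M :: "('a, 'b, 'c) atom set"
      unfolding us_def by (intro map_cong refl eval_herbrand_interp_cong)
    have ip: "ipred (herbrand_interp F N) p us \<longleftrightarrow> Atom p us \<in> N"
      for N :: "('a, 'b, 'c) atom set"
      by (simp add: herbrand_interp_def)
    show ?thesis
      unfolding Atom sat_atom.simps ev ip by (rule Inter_iff)
  qed
  have dom: "idom (herbrand_interp F M) = herbrand_universe F" for M :: "('a, 'b, 'c) atom set"
    by (simp add: herbrand_interp_def)
  show ?thesis
    using ne mods unfolding herbrand_model_def is_model_def true_clause_def dom sat by blast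
qed

lemma least_herbrand_model_eq:
  assumes "wf_program F R P"
  shows "least_herbrand_model F R P = \<Inter>{M. herbrand_model F R P M}"
  unfolding least_herbrand_model_def
proof (rule Least_equality)
  show "herbrand_model F R P (\<Inter>{M. herbrand_model F R P M})"
    using herbrand_model_base[OF assms] by (intro herbrand_model_Inter) auto
qed auto

lemma entails_inj:
  fixes g :: "'d \<Rightarrow> 'u" and P :: "('f, 'p, 'v) program"
  assumes g: "inj g" and ent: "entails TYPE('u) F P Q"
  shows "entails TYPE('d) F P Q"
  unfolding entails_def
proof (intro allI impI)
  fix I :: "('f, 'p, 'd) interp"
  assume I: "is_interp F I" and P: "is_model I P"
  let ?h = "inv g"
  define J :: "('f, 'p, 'u) interp" where "J = \<lparr>idom = g ` idom I,
    ifun = (\<lambda>f us. g (ifun I f (map ?h us))), ipred = (\<lambda>p us. ipred I p (map ?h us))\<rparr>"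
  have J [simp]: "idom J = g ` idom I" "ifun J f us = g (ifun I f (map ?h us))"
    "ipred J p us = ipred I p (map ?h us)" for f p us
    by (simp_all add: J_def)
  have hg [simp]: "?h (g d) = d" for d using g by simp
  have ev: "eval J (\<lambda>x. g (\<alpha> x)) t = g (eval I \<alpha> t)" for \<alpha> :: "'v \<Rightarrow> 'd" and t
  proof (induction t)
    case (Fun f ts)
    have "map (?h \<circ> eval J (\<lambda>x. g (\<alpha> x))) ts = map (eval I \<alpha>) ts"
      using Fun by simp
    then show ?case by (simp del: map_eq_conv)
  qed simp
  have sat: "sat_atom J (\<lambda>x. g (\<alpha> x)) A \<longleftrightarrow> sat_atom I \<alpha> A" for \<alpha> :: "'v \<Rightarrow> 'd" and A
  proof (cases A)
    case (Atom p ts)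
    have "map (?h \<circ> eval J (\<lambda>x. g (\<alpha> x))) ts = map (eval I \<alpha>) ts"
      using ev by simp
    then show ?thesis using Atom by (simp del: map_eq_conv)
  qed
  have split: "\<exists>\<alpha>. \<beta> = (\<lambda>x. g (\<alpha> x)) \<and> range \<alpha> \<subseteq> idom I"
    if \<beta>: "range \<beta> \<subseteq> g ` idom I" for \<beta> :: "'v \<Rightarrow> 'u"
  proof -
    have "\<forall>x. \<exists>d. \<beta> x = g d \<and> d \<in> idom I" using \<beta> by blast
    then obtain \<alpha> where "\<forall>x. \<beta> x = g (\<alpha> x) \<and> \<alpha> x \<in> idom I" by metis
    then show ?thesis by (intro exI[of _ \<alpha>]) auto
  qed
  have "is_interp F J"
    unfolding is_interp_def
  proof (intro conjI ballI, goal_cases)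
    case 1
    then show ?case using I by (simp add: is_interp_def)
  next
    case (2 fn)
    obtain f n where fn: "fn = (f, n)" by (cases fn)
    have "ifun J f us \<in> idom J" if us: "length us = n" "set us \<subseteq> g ` idom I" for us
    proof -
      have "set (map ?h us) \<subseteq> idom I" using us(2) by auto
      moreover have "\<forall>ds. length ds = n \<and> set ds \<subseteq> idom I \<longrightarrow> ifun I f ds \<in> idom I"
        using I 2 fn by (auto simp: is_interp_def)
      ultimately have "ifun I f (map ?h us) \<in> idom I"
        using us(1) by (metis length_map)
      then show ?thesis by simp
    qed
    then show ?case by (simp add: fn)
  qed
  moreover have "is_model J P"
    unfolding is_model_def true_clause_def
  proof (intro ballI allI impI)
    fix C and \<beta> :: "'v \<Rightarrow> 'u"
    assume C: "C \<in> P" and \<beta>: "range \<beta> \<subseteq> idom J" and B: "\<forall>B \<in> set (body C). sat_atom J \<beta> B"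
    obtain \<alpha> where \<alpha>: "\<beta> = (\<lambda>x. g (\<alpha> x))" "range \<alpha> \<subseteq> idom I" using split \<beta> unfolding J by blast
    have "\<forall>B \<in> set (body C). sat_atom I \<alpha> B" using B unfolding \<alpha>(1) sat .
    then have "sat_atom I \<alpha> (head C)"
      using P C \<alpha>(2) by (simp add: is_model_def true_clause_def)
    then show "sat_atom J \<beta> (head C)" unfolding \<alpha>(1) sat .
  qed
  ultimately have Q: "true_query J Q"
    using ent unfolding entails_def by blast
  show "true_query I Q"
    unfolding true_query_def
  proof (intro allI impI ballI)
    fix \<alpha> :: "'v \<Rightarrow> 'd" and A
    assume "range \<alpha> \<subseteq> idom I" and A: "A \<in> set Q"
    then have "range (\<lambda>x. g (\<alpha> x)) \<subseteq> idom J" by auto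
    then have "sat_atom J (\<lambda>x. g (\<alpha> x)) A"
      using Q A unfolding true_query_def by blast
    then show "sat_atom I \<alpha> A" unfolding sat .
  qed
qed

end

theory Submission
  imports Defs
begin

text \<open>For the nontrivial direction, let \<open>I\<close> be a model of \<open>P\<close>, \<open>\<alpha>\<close> a valuation and \<open>A\<close> an atom of \<open>Q\<close>.
  Choose a ground substitution \<open>\<sigma>\<close> that is injective on the variables of \<open>A\<close>, whose values have root
  symbols not occurring in \<open>P\<close>, and such that no nonvariable subterm of \<open>A\<close> is mapped by \<open>\<sigma>\<close> to some
  \<open>\<sigma> x\<close>. Evaluate ground terms in \<open>I\<close>, except that \<open>\<sigma> x\<close> gets the value \<open>\<alpha> x\<close>. The ground atoms true
  under this evaluation form a Herbrand model of \<open>P\<close>, as \<open>P\<close> cannot see the exception; so they include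
  \<open>A\<sigma>\<close>, and \<open>A\<sigma>\<close> is evaluated exactly as \<open>A\<close> is under \<open>\<alpha>\<close>. Distinct fresh constants provide \<open>\<sigma>\<close>
  in case (b); in case (a), towers of the fresh function symbol do, if their heights differ
  by more than the size of \<open>A\<close>.\<close>

section \<open>Ground terms, subterms and dependence on variables\<close>

lemma herbrand_interp_simps [simp]:
  "idom (herbrand_interp F M) = herbrand_universe F"
  "ifun (herbrand_interp F M) = Fun"
  "ipred (herbrand_interp F M) p ts \<longleftrightarrow> Atom p ts \<in> M"
  by (simp_all add: herbrand_interp_def)

lemma Fun_in_herbrand_universe_iff:
  "Fun f ts \<in> herbrand_universe F \<longleftrightarrow> (f, length ts) \<in> F \<and> set ts \<subseteq> herbrand_universe F"
  by (auto simp: herbrand_universe_def)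

lemma Var_notin_herbrand_universe [simp]: "Var x \<notin> herbrand_universe F"
  by (simp add: herbrand_universe_def)

lemma finite_vars_term: "finite (vars_term t)"
  by (induction t) auto

lemma finite_vars_atom: "finite (vars_atom A)"
  by (cases A) (auto simp: finite_vars_term)

fun subterms :: "('f, 'v) term \<Rightarrow> ('f, 'v) term set" where
  "subterms (Var x) = {Var x}"
| "subterms (Fun f ts) = insert (Fun f ts) (\<Union>t \<in> set ts. subterms t)"

fun subterms_atom :: "('f, 'p, 'v) atom \<Rightarrow> ('f, 'v) term set" where
  "subterms_atom (Atom p ts) = (\<Union>t \<in> set ts. subterms t)"

lemma finite_subterms: "finite (subterms t)"
  by (induction t) auto

lemma finite_subterms_atom: "finite (subterms_atom A)"
  by (cases A) (auto simp: finite_subterms)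

lemma funas_subterms: "u \<in> subterms t \<Longrightarrow> funas_term u \<subseteq> funas_term t"
  by (induction t) fastforce+

lemma funas_subterms_atom: "u \<in> subterms_atom A \<Longrightarrow> funas_term u \<subseteq> funas_atom A"
  using funas_subterms by (cases A) fastforce

lemma eval_cong:
  "(\<And>x. x \<in> vars_term t \<Longrightarrow> \<alpha> x = \<beta> x) \<Longrightarrow> eval I \<alpha> t = eval I \<beta> t"
proof (induction t)
  case (Fun f ts)
  then have "map (eval I \<alpha>) ts = map (eval I \<beta>) ts" by auto
  then show ?case by (simp del: map_eq_conv)
qed simp

lemma sat_atom_cong:
  assumes "\<And>x. x \<in> vars_atom A \<Longrightarrow> \<alpha> x = \<beta> x"
  shows "sat_atom I \<alpha> A \<longleftrightarrow> sat_atom I \<beta> A"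
proof (cases A)
  case (Atom p ts)
  have "map (eval I \<alpha>) ts = map (eval I \<beta>) ts"
    using assms Atom by (auto intro: eval_cong)
  then show ?thesis using Atom by (simp del: map_eq_conv)
qed


section \<open>Evaluation of ground terms with exceptions\<close>

text \<open>The map \<open>\<rho>\<close> is consulted before the root symbol is interpreted, at
  every level, so an exception also takes effect inside larger terms. The value at variables is
  arbitrary, since only ground terms are of interest.\<close>

fun override_eval ::
  "(('f, 'v) term \<Rightarrow> 'd option) \<Rightarrow> ('f, 'p, 'd) interp \<Rightarrow> ('f, 'v) term \<Rightarrow> 'd" where
  "override_eval \<rho> I (Var x) = undefined"
| "override_eval \<rho> I (Fun f ts) =
    (case \<rho> (Fun f ts) of Some d \<Rightarrow> d | None \<Rightarrow> ifun I f (map (override_eval \<rho> I) ts))"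

lemma override_eval_in_idom:
  assumes "is_interp F I" and "ran \<rho> \<subseteq> idom I" and "t \<in> herbrand_universe F"
  shows "override_eval \<rho> I t \<in> idom I"
  using assms(3)
proof (induction t)
  case (Fun f ts)
  then have "set (map (override_eval \<rho> I) ts) \<subseteq> idom I" and "(f, length ts) \<in> F"
    by (auto simp: Fun_in_herbrand_universe_iff)
  then have "ifun I f (map (override_eval \<rho> I) ts) \<in> idom I"
    using assms(1) unfolding is_interp_def by (metis (mono_tags, lifting) case_prodD length_map)
  then show ?case
    using assms(2) by (auto split: option.split intro: ranI)
qed simp

text \<open>A substitution lemma: no exception fires at an instance of a nonvariable subterm, so
  evaluation descends through \<open>t\<close> to its variables. Exceptions at the values of
  \<open>\<sigma>\<close> or below them are absorbed into the valuation on the right.\<close>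

lemma override_eval_instance:
  assumes "\<And>f us. Fun f us \<in> subterms t \<Longrightarrow> \<rho> (eval (herbrand_interp F M) \<sigma> (Fun f us)) = None"
  shows "override_eval \<rho> I (eval (herbrand_interp F M) \<sigma> t) = eval I (override_eval \<rho> I \<circ> \<sigma>) t"
  using assms
proof (induction t)
  case (Fun f ts)
  have "override_eval \<rho> I (eval (herbrand_interp F M) \<sigma> t) = eval I (override_eval \<rho> I \<circ> \<sigma>) t"
    if t: "t \<in> set ts" for t
  proof (rule Fun.IH[OF t])
    show "\<rho> (eval (herbrand_interp F M) \<sigma> (Fun g us)) = None" if "Fun g us \<in> subterms t" for g us
      using t that by (intro Fun.prems) auto
  qed
  then have "map (override_eval \<rho> I) (map (eval (herbrand_interp F M) \<sigma>) ts) =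
      map (eval I (override_eval \<rho> I \<circ> \<sigma>)) ts"
    by (simp add: o_def)
  moreover have "\<rho> (Fun f (map (eval (herbrand_interp F M) \<sigma>) ts)) = None"
    using Fun.prems[of f ts] by simp
  ultimately show ?case by (simp del: map_map map_eq_conv comp_apply)
qed simp

text \<open>Pulling \<open>I\<close> back along \<open>override_eval \<rho> I\<close> gives a
  Herbrand model of \<open>P\<close>, which contains the least one. The set \<open>M\<close> is
  arbitrary because term evaluation in a Herbrand interpretation does not depend on its
  atoms.\<close>

lemma least_herbrand_model_transfer:
  fixes P :: "('f, 'p, 'v) program" and M :: "('f, 'p, 'v) atom set"
  assumes wf: "wf_program F R P" and I: "is_interp F I" "is_model I P"
    and \<rho>: "ran \<rho> \<subseteq> idom I"
    and \<rho>_P: "\<And>f ts. (f, length ts) \<in> funas_program P \<Longrightarrow> \<rho> (Fun f ts) = None"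
    and \<rho>_A: "\<And>f us. Fun f us \<in> subterms_atom A \<Longrightarrow>
      \<rho> (eval (herbrand_interp F M) \<sigma> (Fun f us)) = None"
    and sat: "sat_atom (herbrand_interp F (least_herbrand_model F R P)) \<sigma> A"
  shows "sat_atom I (override_eval \<rho> I \<circ> \<sigma>) A"
proof -
  let ?v = "override_eval \<rho> I"
  define N where "N = {B \<in> herbrand_base F R. \<exists>p ts. B = Atom p ts \<and> ipred I p (map ?v ts)}"
  have inst: "ipred I p (map ?v (map (eval (herbrand_interp F K) \<beta>) ts)) \<longleftrightarrow>
      sat_atom I (?v \<circ> \<beta>) (Atom p ts)"
    if "\<And>f us. Fun f us \<in> subterms_atom (Atom p ts) \<Longrightarrow>
      \<rho> (eval (herbrand_interp F K) \<beta> (Fun f us)) = None"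
    for p ts \<beta> and K :: "('f, 'p, 'v) atom set"
  proof -
    have "map ?v (map (eval (herbrand_interp F K) \<beta>) ts) = map (eval I (?v \<circ> \<beta>)) ts"
      using that by (fastforce intro: override_eval_instance)
    then show ?thesis by (simp del: map_eq_conv map_map)
  qed
  have "herbrand_model F R P N"
    unfolding herbrand_model_def is_model_def true_clause_def
  proof (intro conjI ballI allI impI)
    show "N \<subseteq> herbrand_base F R" by (auto simp: N_def)
  next
    fix C and \<beta> :: "'v \<Rightarrow> ('f, 'v) term"
    assume C: "C \<in> P" and \<beta>: "range \<beta> \<subseteq> idom (herbrand_interp F N)"
      and body: "\<forall>B \<in> set (body C). sat_atom (herbrand_interp F N) \<beta> B"
    have sat_iff: "sat_atom (herbrand_interp F N) \<beta> B \<longleftrightarrow> sat_atom I (?v \<circ> \<beta>) B"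
      if B: "B \<in> atoms_clause C" for B
    proof (cases B)
      case (Atom p ts)
      have wf_B: "wf_atom F R (Atom p ts)"
        using wf C B unfolding Atom wf_program_def by blast
      have "eval (herbrand_interp F N) \<beta> t \<in> herbrand_universe F" if t: "t \<in> set ts" for t
      proof (rule eval_herbrand_universe)
        show "range \<beta> \<subseteq> herbrand_universe F" using \<beta> by simp
        show "funas_term t \<subseteq> F" using wf_B t by (auto simp: wf_atom_def)
      qed
      \<comment> \<open>Instances of program atoms lie in the Herbrand base, so their membership in
        \<open>N\<close> comes down to truth in \<open>I\<close>.\<close>
      then have "Atom p (map (eval (herbrand_interp F N) \<beta>) ts) \<in> herbrand_base F R"
        using wf_B by (auto simp: herbrand_base_def wf_atom_def herbrand_universe_def)
      then have "sat_atom (herbrand_interp F N) \<beta> B \<longleftrightarrow>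
          ipred I p (map ?v (map (eval (herbrand_interp F N) \<beta>) ts))"
        by (simp add: Atom N_def)
      also have "\<dots> \<longleftrightarrow> sat_atom I (?v \<circ> \<beta>) (Atom p ts)"
      proof (rule inst)
        \<comment> \<open>Instantiation keeps the root symbol of a nonvariable subterm; that symbol
          occurs in \<open>P\<close>, where \<open>\<rho>\<close> makes no exception.\<close>
        fix f us
        assume "Fun f us \<in> subterms_atom (Atom p ts)"
        then have "funas_term (Fun f us) \<subseteq> funas_atom B"
          unfolding Atom by (rule funas_subterms_atom)
        also have "\<dots> \<subseteq> funas_program P"
          using C B by (auto simp: funas_program_def)
        finally have "funas_term (Fun f us) \<subseteq> funas_program P" .
        then show "\<rho> (eval (herbrand_interp F N) \<beta> (Fun f us)) = None"
          using \<rho>_P by simp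
      qed
      finally show ?thesis by (simp add: Atom)
    qed
    have "range (?v \<circ> \<beta>) \<subseteq> idom I"
      using \<beta> override_eval_in_idom[OF I(1) \<rho>] by auto
    then show "sat_atom (herbrand_interp F N) \<beta> (head C)"
      using I(2) C body sat_iff unfolding is_model_def true_clause_def atoms_clause_def by auto
  qed
  then have sub: "least_herbrand_model F R P \<subseteq> N"
    unfolding least_herbrand_model_eq[OF wf] by blast
  obtain p ts where A: "A = Atom p ts" by (cases A)
  have "map (eval (herbrand_interp F (least_herbrand_model F R P)) \<sigma>) ts =
      map (eval (herbrand_interp F M) \<sigma>) ts"
    by (intro map_cong refl eval_herbrand_interp_cong)
  then have "Atom p (map (eval (herbrand_interp F M) \<sigma>) ts) \<in> N"
    using sat sub A by (auto simp del: map_eq_conv)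
  then show ?thesis
    using inst[of p ts M \<sigma>] \<rho>_A unfolding A N_def by blast
qed


section \<open>Separating substitutions\<close>

text \<open>The last conjunct keeps an exception meant for a variable from firing at a nonvariable
  subterm of \<open>A\<close>. The empty set of atoms is a placeholder: \<open>eval\<close> merely
  applies the substitution.\<close>

definition separating ::
  "('f \<times> nat) set \<Rightarrow> ('f, 'p, 'v) program \<Rightarrow> ('f, 'p, 'v) atom \<Rightarrow> ('v \<Rightarrow> ('f, 'v) term) \<Rightarrow> bool" where
  "separating F P A \<sigma> \<longleftrightarrow> range \<sigma> \<subseteq> herbrand_universe F \<and> inj_on \<sigma> (vars_atom A) \<and>
    (\<forall>x \<in> vars_atom A. \<forall>f ts. \<sigma> x = Fun f ts \<longrightarrow> (f, length ts) \<notin> funas_program P) \<and>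
    (\<forall>x \<in> vars_atom A. \<forall>f us. Fun f us \<in> subterms_atom A \<longrightarrow>
      eval (herbrand_interp F ({} :: ('f, 'p, 'v) atom set)) \<sigma> (Fun f us) \<noteq> \<sigma> x)"

lemma separating_imp_sat:
  fixes P :: "('f, 'p, 'v) program"
  assumes wf: "wf_program F R P" and I: "is_interp F I" "is_model I P"
    and sep: "separating F P A \<sigma>" and \<alpha>: "range \<alpha> \<subseteq> idom I"
    and sat: "sat_atom (herbrand_interp F (least_herbrand_model F R P)) \<sigma> A"
  shows "sat_atom I \<alpha> A"
proof -
  \<comment> \<open>Injectivity of \<open>\<sigma>\<close> on the variables of \<open>A\<close>
    makes \<open>\<alpha> x\<close> the value of the exception at \<open>\<sigma> x\<close>.\<close>
  define \<rho> where "\<rho> t = (if t \<in> \<sigma> ` vars_atom A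
    then Some (\<alpha> (the_inv_into (vars_atom A) \<sigma> t)) else None)" for t
  have "sat_atom I (override_eval \<rho> I \<circ> \<sigma>) A"
  proof (rule least_herbrand_model_transfer[OF wf I])
    show "ran \<rho> \<subseteq> idom I" using \<alpha> by (auto simp: \<rho>_def ran_def)
    show "\<rho> (Fun f ts) = None" if "(f, length ts) \<in> funas_program P" for f ts
      using sep that unfolding separating_def \<rho>_def by (metis imageE)
    show "\<rho> (eval (herbrand_interp F ({} :: ('f, 'p, 'v) atom set)) \<sigma> (Fun f us)) = None"
      if "Fun f us \<in> subterms_atom A" for f us
    proof -
      have "eval (herbrand_interp F ({} :: ('f, 'p, 'v) atom set)) \<sigma> (Fun f us) \<notin> \<sigma> ` vars_atom A"
        using sep that unfolding separating_def by blast
      then show ?thesis by (simp add: \<rho>_def)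
    qed
  qed (fact sat)
  moreover have "(override_eval \<rho> I \<circ> \<sigma>) x = \<alpha> x" if x: "x \<in> vars_atom A" for x
  proof -
    have "\<sigma> x \<in> herbrand_universe F" using sep by (auto simp: separating_def)
    then obtain f ts where f: "\<sigma> x = Fun f ts" by (cases "\<sigma> x") auto
    have "\<rho> (\<sigma> x) = Some (\<alpha> x)"
      using x sep by (auto simp: \<rho>_def separating_def the_inv_into_f_f)
    then show ?thesis by (simp add: f)
  qed
  ultimately show ?thesis using sat_atom_cong[of A] by blast
qed

text \<open>An instance of a nonvariable term is a constant only if the term is that constant, and
  the members of \<open>C\<close> do not occur in \<open>A\<close>.\<close>

lemma separating_constants:
  assumes ne: "herbrand_universe F \<noteq> ({} :: ('f, 'v) term set)"
    and C: "finite C" "card C = card (vars_atom A)"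
    "\<forall>c \<in> C. (c, 0) \<in> F \<and> (c, 0) \<notin> funas_program P \<and> (c, 0) \<notin> funas_atom A"
  shows "\<exists>\<sigma>. separating F P (A :: ('f, 'p, 'v) atom) \<sigma>"
proof -
  obtain t\<^sub>0 :: "('f, 'v) term" where t\<^sub>0: "t\<^sub>0 \<in> herbrand_universe F" using ne by blast
  obtain h where h: "bij_betw h (vars_atom A) C"
    using finite_same_card_bij[OF finite_vars_atom C(1)] C(2) by metis
  \<comment> \<open>Variables outside \<open>A\<close> also need ground values;
    \<open>t\<^sub>0\<close> serves for all of them.\<close>
  define \<sigma> where "\<sigma> x = (if x \<in> vars_atom A then Fun (h x) [] else t\<^sub>0)" for x
  have hC: "h x \<in> C" if "x \<in> vars_atom A" for x
    using h that by (auto simp: bij_betw_def)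
  have "separating F P A \<sigma>"
    unfolding separating_def
  proof (intro conjI ballI allI impI)
    show "range \<sigma> \<subseteq> herbrand_universe F"
      using t\<^sub>0 hC C(3) by (auto simp: \<sigma>_def Fun_in_herbrand_universe_iff)
    show "inj_on \<sigma> (vars_atom A)"
      using h by (auto simp: \<sigma>_def bij_betw_def inj_on_def)
    show "(f, length ts) \<notin> funas_program P" if "x \<in> vars_atom A" "\<sigma> x = Fun f ts" for x f ts
      using that hC C(3) by (auto simp: \<sigma>_def)
    show "eval (herbrand_interp F {}) \<sigma> (Fun f us) \<noteq> \<sigma> x"
      if "x \<in> vars_atom A" "Fun f us \<in> subterms_atom A" for x f us
      using that hC C(3) funas_subterms_atom[OF that(2)] by (auto simp: \<sigma>_def)
  qed
  then show ?thesis by blast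
qed

section \<open>Towers of a fresh function symbol\<close>

definition tower :: "'f \<Rightarrow> nat \<Rightarrow> ('f, 'v) term \<Rightarrow> nat \<Rightarrow> ('f, 'v) term" where
  "tower f n t k = ((\<lambda>u. Fun f (replicate n u)) ^^ k) t"

lemma tower_simps [simp]:
  "tower f n t 0 = t" "tower f n t (Suc k) = Fun f (replicate n (tower f n t k))"
  by (simp_all add: tower_def)

lemma tower_in_herbrand_universe:
  "(f, n) \<in> F \<Longrightarrow> t \<in> herbrand_universe F \<Longrightarrow> tower f n t k \<in> herbrand_universe F"
  by (induction k) (auto simp: Fun_in_herbrand_universe_iff)

text \<open>Positive arity makes the size grow strictly with the height.\<close>

lemma inj_tower:
  assumes "n > 0"
  shows "inj (tower f n t)"
proof -
  have "strict_mono (\<lambda>k. size (tower f n t k))"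
    unfolding strict_mono_Suc_iff
  proof
    fix k
    have "tower f n t k \<in> set (replicate n (tower f n t k))" using assms by simp
    then show "size (tower f n t k) < size (tower f n t (Suc k))"
      by (simp add: size_list_estimation' less_Suc_eq_le)
  qed
  then have "inj (\<lambda>k. size (tower f n t k))" by (rule strict_mono_imp_inj_on)
  then show ?thesis by (auto simp: inj_def)
qed

text \<open>Descend along first arguments in \<open>s\<close> and in the tower in parallel. Either
  the base of the tower is reached inside \<open>s\<close>, so \<open>m \<le> size s\<close>, or a
  variable \<open>x\<close> is met after some \<open>d \<le> size s\<close> steps, so
  \<open>m = k x + d\<close>, with \<open>d > 0\<close> unless \<open>s\<close> is a
  variable.\<close>

lemma instance_eq_tower:
  assumes "n > 0" and "eval (herbrand_interp F M) (\<lambda>x. tower f n t (k x)) s = tower f n t m"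
  shows "m \<le> size s \<or> (\<exists>x \<in> vars_term s. k x \<le> m \<and> m \<le> k x + size s \<and> (s = Var x \<or> k x < m))"
  using assms(2)
proof (induction s arbitrary: m)
  case (Var x)
  then show ?case using injD[OF inj_tower[OF assms(1)]] by fastforce
next
  case (Fun g ss)
  show ?case
  proof (cases m)
    case (Suc l)
    have eq: "map (eval (herbrand_interp F M) (\<lambda>x. tower f n t (k x))) ss =
        replicate n (tower f n t l)"
      using Fun.prems Suc by simp
    have len: "length ss = n" using arg_cong[OF eq, of length] by simp
    \<comment> \<open>Any argument would do; one exists because the arity is positive.\<close>
    define s where "s = ss ! 0"
    have s: "s \<in> set ss" "eval (herbrand_interp F M) (\<lambda>x. tower f n t (k x)) s = tower f n t l"
      using assms(1) len arg_cong[OF eq, of "\<lambda>us. us ! 0"] by (simp_all add: s_def)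
    have "size s < size (Fun g ss)"
      using s(1) by (simp add: size_list_estimation' less_Suc_eq_le)
    with Fun.IH[OF s] s(1) Suc show ?thesis by fastforce
  qed simp
qed

lemma separating_towers:
  assumes ne: "herbrand_universe F \<noteq> ({} :: ('f, 'v) term set)"
    and f: "(f, n) \<in> F" "n > 0" "(f, n) \<notin> funas_program P"
  shows "\<exists>\<sigma>. separating F P (A :: ('f, 'p, 'v) atom) \<sigma>"
proof -
  obtain t\<^sub>0 :: "('f, 'v) term" where t\<^sub>0: "t\<^sub>0 \<in> herbrand_universe F" using ne by blast
  obtain i :: "'v \<Rightarrow> nat" where i: "inj_on i (vars_atom A)"
    using finite_imp_inj_to_nat_seg[OF finite_vars_atom] by metis
  define N where "N = Suc (\<Sum>u \<in> subterms_atom A. size u)"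
  have size: "size u < N" if "u \<in> subterms_atom A" for u
    using member_le_sum[OF that, of size] finite_subterms_atom by (auto simp: N_def less_Suc_eq_le)
  \<comment> \<open>Heights are positive multiples of \<open>N\<close>. Positivity puts
    \<open>f\<close> at the root of each value and rules out the alternative
    \<open>m \<le> size s\<close> of \<open>instance_eq_tower\<close>; distinct heights differ by at
    least \<open>N\<close>.\<close>
  define k where "k x = Suc (i x) * N" for x
  define \<sigma> where "\<sigma> = (\<lambda>x. tower f n t\<^sub>0 (k x))"
  have "separating F P A \<sigma>"
    unfolding separating_def
  proof (intro conjI ballI allI impI)
    show "range \<sigma> \<subseteq> herbrand_universe F"
      using t\<^sub>0 f(1) tower_in_herbrand_universe by (fastforce simp: \<sigma>_def)
    have "inj_on k (vars_atom A)"
      using i by (simp add: inj_on_def k_def N_def del: mult_Suc mult_Suc_right)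
    then show "inj_on \<sigma> (vars_atom A)"
      unfolding \<sigma>_def inj_on_def using injD[OF inj_tower[OF f(2)], of f t\<^sub>0] by auto
    show "(g, length ts) \<notin> funas_program P" if "x \<in> vars_atom A" "\<sigma> x = Fun g ts" for x g ts
    proof -
      obtain l where "k x = Suc l" by (cases "k x") (auto simp: k_def N_def)
      then show ?thesis using that(2) f(3) by (auto simp: \<sigma>_def)
    qed
    show "eval (herbrand_interp F {}) \<sigma> (Fun g us) \<noteq> \<sigma> x"
      if x: "x \<in> vars_atom A" and u: "Fun g us \<in> subterms_atom A" for x g us
    proof
      assume "eval (herbrand_interp F {}) \<sigma> (Fun g us) = \<sigma> x"
      from instance_eq_tower[OF f(2) this[unfolded \<sigma>_def]]
      have "k x \<le> size (Fun g us) \<or> (\<exists>y. k y < k x \<and> k x \<le> k y + size (Fun g us))"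
        by blast
      moreover have "N \<le> k x" by (simp add: k_def)
      ultimately obtain y where y: "k y < k x" "k x < k y + N"
        using size[OF u] by (meson leD le_less_trans less_le_trans nat_add_left_cancel_less)
      \<comment> \<open>The height \<open>k x\<close> would lie strictly between the consecutive
        multiples \<open>k y\<close> and \<open>k y + N\<close> of \<open>N\<close>.\<close>
      have "k y + N = Suc (Suc (i y)) * N" by (simp add: k_def)
      then have "i y < i x" "i x < Suc (i y)"
        using y unfolding k_def by (simp_all only: mult_less_cancel2 Suc_less_eq)
      then show False by simp
    qed
  qed
  then show ?thesis by blast
qed


section \<open>Truth in the least Herbrand model and logical consequence\<close>

text \<open>The least Herbrand model is an interpretation over the type of terms and a model of
  \<open>P\<close>, so the entailment applies to it.\<close>

lemma entails_imp_least_herbrand_model: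
  fixes P :: "('f, 'p, 'v) program"
  assumes ne: "herbrand_universe F \<noteq> ({} :: ('f, 'v) term set)" and wf: "wf_program F R P"
    and ent: "entails TYPE(('f, 'v) term) F P Q"
  shows "true_query (herbrand_interp F (least_herbrand_model F R P)) Q"
proof -
  have "is_interp F (herbrand_interp F (least_herbrand_model F R P))"
    using ne by (auto simp: is_interp_def Fun_in_herbrand_universe_iff)
  moreover have "herbrand_model F R P (least_herbrand_model F R P)"
    unfolding least_herbrand_model_eq[OF wf]
    using herbrand_model_base[OF wf] by (intro herbrand_model_Inter) auto
  ultimately show ?thesis
    using ent by (auto simp: entails_def herbrand_model_def)
qed

theorem theorem1:
  fixes F :: "('f \<times> nat) set" and R :: "('p \<times> nat) set"
    and P :: "('f, 'p, 'v) program" and Q :: "('f, 'p, 'v) query"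
  assumes "herbrand_universe F \<noteq> ({} :: ('f, 'v) term set)"
    and "wf_program F R P"
    and "wf_query F R Q"
    and "(\<exists>f n. (f, n) \<in> F \<and> n > 0 \<and> (f, n) \<notin> funas_program P) \<or>
      (\<forall>A \<in> set Q. \<exists>C. finite C \<and> card C = card (vars_atom A) \<and>
        (\<forall>c \<in> C. (c, 0) \<in> F \<and> (c, 0) \<notin> funas_program P \<and> (c, 0) \<notin> funas_atom A))"
  shows "true_query (herbrand_interp F (least_herbrand_model F R P)) Q \<longleftrightarrow>
    entails TYPE('d + ('f, 'v) term) F P Q"
proof
  assume true: "true_query (herbrand_interp F (least_herbrand_model F R P)) Q"
  show "entails TYPE('d + ('f, 'v) term) F P Q"
    unfolding entails_def true_query_def
  proof (intro allI impI ballI)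
    fix I :: "('f, 'p, 'd + ('f, 'v) term) interp" and \<alpha> :: "'v \<Rightarrow> 'd + ('f, 'v) term" and A
    assume I: "is_interp F I" "is_model I P" and \<alpha>: "range \<alpha> \<subseteq> idom I" and A: "A \<in> set Q"
    \<comment> \<open>The substitution depends on \<open>A\<close>, so the fresh constants may
      differ from atom to atom.\<close>
    obtain \<sigma> where \<sigma>: "separating F P A \<sigma>"
      using assms(4) separating_towers[OF assms(1)] separating_constants[OF assms(1)] A by metis
    then have "sat_atom (herbrand_interp F (least_herbrand_model F R P)) \<sigma> A"
      using true A by (simp add: true_query_def separating_def)
    then show "sat_atom I \<alpha> A"
      by (rule separating_imp_sat[OF assms(2) I \<sigma> \<alpha>])
  qed
next
  assume "entails TYPE('d + ('f, 'v) term) F P Q"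
  \<comment> \<open>The embedding \<open>Inr\<close> passes entailment from the sum type down to
    domains of terms, where the Herbrand interpretations live.\<close>
  then have "entails TYPE(('f, 'v) term) F P Q"
    by (rule entails_inj[OF inj_Inr])
  then show "true_query (herbrand_interp F (least_herbrand_model F R P)) Q"
    by (rule entails_imp_least_herbrand_model[OF assms(1,2)])
qed

end
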